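(* For infinitely many values of $n$ the following inequality holds: $$\frac{p_{n+1}^{\frac{1}{n+1}}}{p_{n}^{\frac{1}{n}}}<\frac{\ln(n+1)+p_{n+1}^{-1+\frac{1}{n+1}}}{\ln(n)}.$$ Moreover, $$\liminf_{n\to\infty}\frac{p_{n+1}^{\frac{1}{n+1}}}{p_{n}^{\frac{1}{n}}}\leq 1.$$
   Context: $p_n$ denotes the $n$th prime number; $\ln$ is the natural logarithm. (The displayed inequality is considered for $n\ge 2$, where $\ln(n)>0$.) *)

theory Defs
  imports
    "HOL-Analysis.Analysis"
    "HOL-Computational_Algebra.Primes"
begin

(* enumerate counts from 0, whereas nth_prime 1 = 2, nth_prime 2 = 3, ...;
   the value nth_prime 0 = 2 is junk. *)
definition nth_prime :: "nat \<Rightarrow> nat" where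
  "nth_prime n = enumerate {p::nat. prime p} (n - 1)"

end

theory Submission
  imports Defs "HOL-Computational_Algebra.Squarefree"
begin

text \<open>
  Writing each \<open>m \<le> p\<^sub>n\<close> as a squarefree number times a square gives
  \<open>p\<^sub>n \<le> 2 ^ n * sqrt p\<^sub>n\<close>, that is \<open>p\<^sub>n \<le> 4 ^ n\<close>, so \<open>a\<^sub>n = p\<^sub>n powr (1 / n)\<close> is bounded.
  A bounded positive sequence cannot eventually grow at least as fast as one tending to
  infinity; comparing the ratios of \<open>a\<close> with those of \<open>ln n\<close> and of \<open>q ^ n\<close> for \<open>q > 1\<close>
  yields the two claims.
\<close>

text \<open>A number is determined by the primes dividing its squarefree part together with its
  square part. For \<open>m\<close> in \<open>{1..x}\<close> this leaves at most
  \<open>2 ^ card ?P\<close> choices for the former and \<open>floor_sqrt x\<close> for the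
  latter.\<close>

lemma le_4_power_card_primes:
  fixes x :: nat
  shows "x \<le> 4 ^ card {p. prime p \<and> p \<le> x}"
proof -
  let ?P = "{p::nat. prime p \<and> p \<le> x}"
  define s where "s = floor_sqrt x"
  let ?f = "\<lambda>m::nat. (prime_factors (squarefree_part m), square_part m)"
  have fin: "finite ?P" by (rule finite_subset[of _ "{..x}"]) auto
  have "inj_on ?f {1..x}"
  proof (rule inj_onI)
    fix m n assume eq: "?f m = ?f n"
    \<comment> \<open>All multiplicities in a squarefree number are at most 1, so the set of its
      primes recovers it; this is what makes \<open>?f\<close> injective.\<close>
    have "squarefree_part k = \<Prod>(prime_factors (squarefree_part k))" for k :: nat
    proof -
      have "squarefree_part k = (\<Prod>p\<in>prime_factors (squarefree_part k). p ^ multiplicity p (squarefree_part k))"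
        by (simp add: prod_prime_factors)
      also have "\<dots> = \<Prod>(prime_factors (squarefree_part k))"
      proof (rule prod.cong)
        fix p assume "p \<in> prime_factors (squarefree_part k)"
        hence "multiplicity p (squarefree_part k) > 0" "prime p"
          by (auto simp: prime_factors_multiplicity)
        moreover from \<open>prime p\<close> have "multiplicity p (squarefree_part k) \<le> Suc 0" by blast
        ultimately show "p ^ multiplicity p (squarefree_part k) = p"
          by (metis Suc_leI le_antisym power_Suc0_right)
      qed simp
      finally show ?thesis .
    qed
    hence "squarefree_part m = squarefree_part n" using eq by (metis prod.inject)
    thus "m = n" using eq by (metis prod.inject squarefree_decompose)
  qed
  moreover have "?f ` {1..x} \<subseteq> Pow ?P \<times> {1..s}"
  proof (rule image_subsetI)
    fix m assume m: "m \<in> {1..x}"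
    have "squarefree_part m \<le> m" "square_part m ^ 2 \<le> m"
      using m squarefree_decompose[of m] by (auto intro!: dvd_imp_le simp: dvd_def)
    moreover have "0 < squarefree_part m" "1 \<le> square_part m"
      using m by (simp_all add: Suc_le_eq flip: neq0_conv)
    ultimately show "?f m \<in> Pow ?P \<times> {1..s}"
      using m by (auto simp: s_def le_floor_sqrt_iff in_prime_factors_iff dest!: dvd_imp_le)
  qed
  ultimately have "card {1..x} \<le> card (Pow ?P \<times> {1..s})"
    using fin by (intro card_inj_on_le) auto
  hence "x \<le> 2 ^ card ?P * s"
    using fin by (simp add: card_cartesian_product card_Pow)
  \<comment> \<open>Squaring allows the integer root to be removed through
    \<open>s ^ 2 \<le> x\<close>; one factor \<open>x\<close> then cancels.\<close>
  hence "x ^ 2 \<le> (2 ^ card ?P * s) ^ 2" by (rule power_mono) simp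
  also have "\<dots> = 4 ^ card ?P * s ^ 2"
    by (simp add: power_mult_distrib flip: power_mult) (simp add: power_mult mult.commute)
  also have "\<dots> \<le> 4 ^ card ?P * x" by (simp add: s_def)
  finally show ?thesis by (cases "x = 0") (auto simp: power2_eq_square)
qed

lemma nth_prime_le:
  assumes "n \<ge> 1"
  shows "nth_prime n \<le> 4 ^ n"
proof -
  let ?S = "{p::nat. prime p}"
  have inf: "infinite ?S" by (rule primes_infinite)
  \<comment> \<open>The primes up to \<open>nth_prime n\<close> have enumeration indices
    \<open>0\<close> to \<open>n - 1\<close>, hence there are at most \<open>n\<close> of
    them.\<close>
  have "{p. prime p \<and> p \<le> nth_prime n} \<subseteq> enumerate ?S ` {..<n}"
  proof
    fix p assume p: "p \<in> {p. prime p \<and> p \<le> nth_prime n}"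
    then obtain k where k: "p = enumerate ?S k" using enumerate_Ex[of ?S p] inf by auto
    with p have "k \<le> n - 1"
      by (simp add: nth_prime_def inf)
    thus "p \<in> enumerate ?S ` {..<n}" using k assms by auto
  qed
  hence "card {p. prime p \<and> p \<le> nth_prime n} \<le> n"
    using card_image_le[of "{..<n}" "enumerate ?S"] card_mono[OF finite_imageI[OF finite_lessThan]]
    by (metis card_lessThan finite_lessThan le_trans)
  hence "(4::nat) ^ card {p. prime p \<and> p \<le> nth_prime n} \<le> 4 ^ n" by (intro power_increasing) auto
  thus ?thesis using le_4_power_card_primes le_trans by blast
qed

lemma nth_prime_pos: "nth_prime n > 0"
  using enumerate_in_set[OF primes_infinite] by (auto simp: nth_prime_def intro: prime_gt_0_nat)

lemma nth_prime_root_le: "real (nth_prime n) powr (1 / real n) \<le> 4"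
\<comment> \<open>At \<open>n = 0\<close> the exponent \<open>1 / 0\<close> is \<open>0\<close>, so
  the power is 1 and the bound holds for every \<open>n\<close>.\<close>
proof (cases "n = 0")
  case False
  have "real (nth_prime n) \<le> 4 ^ n"
    using nth_prime_le[of n] False by (metis One_nat_def Suc_leI neq0_conv of_nat_le_iff of_nat_numeral of_nat_power)
  hence "real (nth_prime n) powr (1 / real n) \<le> (4 ^ n) powr (1 / real n)"
    by (intro powr_mono2) auto
  also have "\<dots> = 4" using False by (simp add: powr_powr flip: powr_realpow)
  finally show ?thesis .
qed (use nth_prime_pos[of 0] in simp)

text \<open>Otherwise \<open>a n / b n\<close> is nondecreasing from some \<open>N\<close> on, and
  the bound \<open>C\<close> on \<open>a\<close> carries over to a bound on
  \<open>b\<close>.\<close>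

lemma frequently_ratio_less_ratio:
  fixes a b :: "nat \<Rightarrow> real"
  assumes a: "\<And>n. 0 < a n" "\<And>n. a n \<le> C" and b: "filterlim b at_top sequentially"
  shows "\<exists>\<^sub>F n in sequentially. a (Suc n) / a n < b (Suc n) / b n"
proof (rule ccontr)
  assume "\<not> ?thesis"
  \<comment> \<open>Positivity of \<open>b\<close>, which holds only eventually, is recorded to
    allow cross-multiplication.\<close>
  hence "\<forall>\<^sub>F n in sequentially. b (Suc n) / b n \<le> a (Suc n) / a n \<and> 0 < b n"
    using b by (auto simp: frequently_def not_less filterlim_at_top_dense intro: eventually_conj)
  then obtain N where N: "b (Suc n) / b n \<le> a (Suc n) / a n" "0 < b n" if "n \<ge> N" for n
    by (auto simp: eventually_sequentially)
  have "a N / b N \<le> a n / b n" if "n \<ge> N" for n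
    using that
  proof (induction n rule: dec_induct)
    case (step n)
    have "a n / b n \<le> a (Suc n) / b (Suc n)"
      using N(1)[of n] N(2)[of n] N(2)[of "Suc n"] a(1)[of n] step.hyps by (simp add: field_simps)
    with step.IH show ?case by linarith
  qed simp
  hence le: "b n \<le> C * b N / a N" if "n \<ge> N" for n
  proof -
    have "a N * b n \<le> a n * b N"
      using \<open>n \<ge> N \<Longrightarrow> a N / b N \<le> a n / b n\<close> that N(2)[of n] N(2)[of N] by (simp add: field_simps)
    also have "\<dots> \<le> C * b N" using a(2)[of n] N(2)[of N] by (intro mult_right_mono) auto
    finally show ?thesis using a(1)[of N] by (simp add: field_simps)
  qed
  from b have "\<forall>\<^sub>F n in sequentially. C * b N / a N < b n" by (simp add: filterlim_at_top_dense)
  then obtain M where "C * b N / a N < b n" if "n \<ge> M" for n by (auto simp: eventually_sequentially)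
  with le[of "max M N"] show False by (metis linorder_not_le max.cobounded1 max.cobounded2)
qed

theorem corollary6:
  shows "infinite {n::nat. 2 \<le> n \<and>
           real (nth_prime (n + 1)) powr (1 / real (n + 1)) / real (nth_prime n) powr (1 / real n)
           < (ln (real (n + 1)) + real (nth_prime (n + 1)) powr (- 1 + 1 / real (n + 1))) / ln (real n)}
         \<and> liminf (\<lambda>n. ereal (real (nth_prime (n + 1)) powr (1 / real (n + 1))
                             / real (nth_prime n) powr (1 / real n))) \<le> 1"
proof
  define a where "a = (\<lambda>n. real (nth_prime n) powr (1 / real n))"
  have a: "a n > 0" "a n \<le> 4" for n
    using nth_prime_pos[of n] nth_prime_root_le[of n] by (auto simp: a_def)
  note less = frequently_ratio_less_ratio[of a, OF a]
  have "filterlim (\<lambda>n. ln (real n)) at_top sequentially"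
    by (rule filterlim_compose[OF ln_at_top filterlim_real_sequentially])
  from less[OF this]
  have "\<exists>\<^sub>F n in sequentially. 2 \<le> n \<and> a (n + 1) / a n
          < (ln (real (n + 1)) + real (nth_prime (n + 1)) powr (- 1 + 1 / real (n + 1))) / ln (real n)"
  proof (rule frequently_rev_mp)
    show "\<forall>\<^sub>F n in sequentially. a (Suc n) / a n < ln (real (Suc n)) / ln (real n) \<longrightarrow>
        2 \<le> n \<and> a (n + 1) / a n
          < (ln (real (n + 1)) + real (nth_prime (n + 1)) powr (- 1 + 1 / real (n + 1))) / ln (real n)"
      using eventually_ge_at_top[of 2]
    proof eventually_elim
      case (elim n)
      \<comment> \<open>The extra summand is a nonnegative power, so the inequality with the
        logarithms alone is the stronger one.\<close>
      hence "ln (real (n + 1)) / ln (real n) \<le>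
        (ln (real (n + 1)) + real (nth_prime (n + 1)) powr (- 1 + 1 / real (n + 1))) / ln (real n)"
        by (intro divide_right_mono) auto
      with elim show ?case by auto
    qed
  qed
  thus "infinite {n::nat. 2 \<le> n \<and>
           real (nth_prime (n + 1)) powr (1 / real (n + 1)) / real (nth_prime n) powr (1 / real n)
           < (ln (real (n + 1)) + real (nth_prime (n + 1)) powr (- 1 + 1 / real (n + 1))) / ln (real n)}"
    by (simp add: a_def flip: cofinite_eq_sequentially frequently_cofinite)
  show "liminf (\<lambda>n. ereal (real (nth_prime (n + 1)) powr (1 / real (n + 1))
                             / real (nth_prime n) powr (1 / real n))) \<le> 1"
  proof (rule ccontr)
    assume "\<not> ?thesis"
    hence "1 < liminf (\<lambda>n. ereal (a (n + 1) / a n))" by (simp add: a_def)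
    \<comment> \<open>A real \<open>q\<close> strictly in between exists even if the liminf is
      infinite.\<close>
    then obtain q where q: "1 < ereal q" "ereal q < liminf (\<lambda>n. ereal (a (n + 1) / a n))"
      using ereal_dense2 by blast
    from less_LiminfD[OF q(2)] have ev: "\<forall>\<^sub>F n in sequentially. q < a (n + 1) / a n" by simp
    have "filterlim (\<lambda>n. q ^ n) at_top sequentially"
      using q(1) filterlim_at_infinity_imp_filterlim_at_top[OF filterlim_realpow_sequentially_gt1[of q]]
      by simp
    \<comment> \<open>The comparison sequence \<open>q ^ n\<close> has constant ratio
      \<open>q\<close>.\<close>
    from less[OF this] have "\<exists>\<^sub>F n in sequentially. a (n + 1) / a n < q"
      using q(1) by simp
    from frequently_eventually_conj[OF this ev] show False by (auto dest: frequently_ex)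
  qed
qed

end
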